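(* In the worst violated constraint model, there is no algorithm which, given oracle access to an arbitrary hidden 1SAT instance $\Phi$ (with repeated clauses allowed) which is unsatisfiable, learns all the literals present in $\Phi$, even if the algorithm is allowed arbitrarily many queries to the oracle.
   Context: A 1SAT instance on Boolean variables $x_1,\dots,x_n$ is a conjunction of clauses $C_1,\dots,C_m$, each consisting of a single literal ($x_i$ or $\overline{x}_i$). The same literal may occur as several different clauses. Worst violated constraint model: the formula is hidden and is accessed only through an oracle. A query is a probabilistic assignment $\mathbf{a}:[n]\to[0,1]$, meaning that $\Pr[x_i=1]=\mathbf{a}(i)$ and $\Pr[\overline{x}_i=1]=1-\mathbf{a}(i)$. The violation probability of a clause is the probability that its literal is $0$. If all clauses have violation probability $0$, the oracle reports that the formula is satisfied; otherwise it returns the index $j\in[m]$ of a clause with the highest violation probability, breaking ties arbitrarily. The tie-breaking may be adversarial, and an algorithm is required to be correct for every valid behaviour of the oracle. An algorithm "learns all the literals present in $\Phi$" if it outputs the set of literals that occur as clauses of $\Phi$. *)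

theory Defs
  imports "HOL-Probability.Probability_Mass_Function"
begin

text \<open>Variables and clauses are indexed from 0: the variables of an instance on \<open>n\<close> variables
  are \<open>0, \<dots>, n - 1\<close>, and its clauses are the entries of a list, so that the same literal may
  occur as several clauses.\<close>

datatype literal = Pos nat | Neg nat

primrec var :: "literal \<Rightarrow> nat" where
  "var (Pos i) = i"
| "var (Neg i) = i"

primrec lit_value :: "literal \<Rightarrow> bool \<Rightarrow> bool" where
  "lit_value (Pos i) b = b"
| "lit_value (Neg i) b = (\<not> b)"

definition is_1sat :: "nat \<Rightarrow> literal list \<Rightarrow> bool" where
  "is_1sat n \<Phi> \<longleftrightarrow> (\<forall>l\<in>set \<Phi>. var l < n)"

definition satisfiable :: "literal list \<Rightarrow> bool" where
  "satisfiable \<Phi> \<longleftrightarrow> (\<exists>\<sigma> :: nat \<Rightarrow> bool. \<forall>l\<in>set \<Phi>. lit_value l (\<sigma> (var l)))"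

type_synonym query = "nat \<Rightarrow> real"

definition queries :: "nat \<Rightarrow> query set" where
  "queries n = {..<n} \<rightarrow>\<^sub>E {0..1}"

definition violation_prob :: "query \<Rightarrow> literal \<Rightarrow> real" where
  "violation_prob a l = measure_pmf.prob (bernoulli_pmf (a (var l))) {b. \<not> lit_value l b}"

lemma violation_prob_Pos:
  assumes "a i \<in> {0..1}"
  shows "violation_prob a (Pos i) = 1 - a i"
proof -
  have "{b. \<not> lit_value (Pos i) b} = {False}" by auto
  then show ?thesis
    using assms by (simp add: violation_prob_def measure_pmf_single)
qed

lemma violation_prob_Neg:
  assumes "a i \<in> {0..1}"
  shows "violation_prob a (Neg i) = a i"
proof -
  have "{b. \<not> lit_value (Neg i) b} = {True}" by auto
  then show ?thesis
    using assms by (simp add: violation_prob_def measure_pmf_single)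
qed

datatype response = Satisfied | Violated nat

definition valid_response :: "literal list \<Rightarrow> query \<Rightarrow> response \<Rightarrow> bool" where
  "valid_response \<Phi> a r \<longleftrightarrow>
     (if \<forall>l\<in>set \<Phi>. violation_prob a l = 0 then r = Satisfied
      else \<exists>j<length \<Phi>. r = Violated j \<and>
             (\<forall>k<length \<Phi>. violation_prob a (\<Phi> ! k) \<le> violation_prob a (\<Phi> ! j)))"

type_synonym history = "(query \<times> response) list"

text \<open>The answer to a query may depend on the whole interaction so far (oldest round first), so
  ties may be broken adaptively.\<close>

type_synonym responder = "history \<Rightarrow> query \<Rightarrow> response"

definition valid_responder :: "nat \<Rightarrow> literal list \<Rightarrow> responder \<Rightarrow> bool" where
  "valid_responder n \<Phi> R \<longleftrightarrow> (\<forall>h. \<forall>a\<in>queries n. valid_response \<Phi> a (R h a))"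

datatype action = Query query | Output "literal set"

text \<open>An algorithm is any strategy that chooses its next action from the interaction so far. No
  computability is required and the number of queries is not bounded.\<close>

type_synonym algorithm = "history \<Rightarrow> action"

definition legal_algorithm :: "nat \<Rightarrow> algorithm \<Rightarrow> bool" where
  "legal_algorithm n A \<longleftrightarrow> (\<forall>h a. A h = Query a \<longrightarrow> a \<in> queries n)"

primrec transcript :: "algorithm \<Rightarrow> responder \<Rightarrow> nat \<Rightarrow> history" where
  "transcript A R 0 = []"
| "transcript A R (Suc k) =
     (let h = transcript A R k
      in case A h of Query a \<Rightarrow> h @ [(a, R h a)] | Output S \<Rightarrow> h)"

definition outputs :: "algorithm \<Rightarrow> responder \<Rightarrow> literal set \<Rightarrow> bool" where
  "outputs A R S \<longleftrightarrow> (\<exists>k. A (transcript A R k) = Output S)"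

text \<open>The algorithm is told the number \<open>n\<close> of variables and the number \<open>m\<close> of clauses.\<close>

definition learns_unsatisfiable_1sat :: "(nat \<Rightarrow> nat \<Rightarrow> algorithm) \<Rightarrow> bool" where
  "learns_unsatisfiable_1sat A \<longleftrightarrow>
     (\<forall>n m. legal_algorithm n (A n m)) \<and>
     (\<forall>n \<Phi> R. is_1sat n \<Phi> \<longrightarrow> \<not> satisfiable \<Phi> \<longrightarrow> valid_responder n \<Phi> R \<longrightarrow>
        outputs (A n (length \<Phi>)) R (set \<Phi>))"

end

theory Submission
  imports Defs
begin

text \<open>The instances \<open>x, \<not>x, x, \<not>x\<close> and \<open>x, \<not>x, y, y\<close> cannot be told apart. If \<open>y\<close> is a worst violated
  literal of the second instance, then both of its copies are, and the oracle returns the copy whose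
  index carries a worst violated literal in the first instance; otherwise one of the common clauses
  \<open>x, \<not>x\<close> is worst violated in both instances.\<close>

lemma transcript_const_after_output:
  assumes "A (transcript A R k) = Output S"
  shows "transcript A R (k + d) = transcript A R k"
  using assms by (induction d) (simp_all add: Let_def)

text \<open>The history is frozen after an output, so the histories at rounds \<open>j\<close> and
  \<open>k\<close> both equal the one at round \<open>j + k\<close>, where \<open>A\<close> has only
  one action.\<close>

lemma outputs_unique:
  assumes "outputs A R S" "outputs A R T"
  shows "S = T"
proof -
  obtain j k where j: "A (transcript A R j) = Output S" and k: "A (transcript A R k) = Output T"
    using assms by (auto simp: outputs_def)
  have "transcript A R (j + k) = transcript A R j" "transcript A R (j + k) = transcript A R k"
    using transcript_const_after_output[of A R j S k] transcript_const_after_output[of A R k T j] j k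
    by (simp_all add: add.commute)
  with j k show ?thesis by simp
qed

text \<open>Equal lengths start the learner with the same data \<open>n\<close> and
  \<open>m\<close>, and a responder valid for both instances yields one and the same run, whose
  single output must be correct for each.\<close>

lemma learner_output_determined:
  assumes "learns_unsatisfiable_1sat A" "length \<Phi> = length \<Psi>"
    and "is_1sat n \<Phi>" "\<not> satisfiable \<Phi>" "valid_responder n \<Phi> R"
    and "is_1sat n \<Psi>" "\<not> satisfiable \<Psi>" "valid_responder n \<Psi> R"
  shows "set \<Phi> = set \<Psi>"
proof (rule outputs_unique)
  show "outputs (A n (length \<Phi>)) R (set \<Phi>)"
    using assms(1,3-5) unfolding learns_unsatisfiable_1sat_def by blast
  show "outputs (A n (length \<Phi>)) R (set \<Psi>)"
    using assms(1,6-8) unfolding learns_unsatisfiable_1sat_def assms(2) by blast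
qed

text \<open>The repetition provides a copy of either literal at indices 2 and 3, so one of these
  indices is always a legal answer.\<close>

definition contradiction_twice :: "literal list" where
  "contradiction_twice = [Pos 0, Neg 0, Pos 0, Neg 0]"

definition contradiction_and_var :: "literal list" where
  "contradiction_and_var = [Pos 0, Neg 0, Pos 1, Pos 1]"

text \<open>Indices 2 and 3 are answered exactly when \<open>1 - a 1 > max (a 0) (1 - a 0)\<close>, that is, when
  \<open>Pos 1\<close> is the unique worst violated literal of the second instance.\<close>

definition confusing_responder :: responder where
  "confusing_responder h a =
     (if a 0 \<le> 1/2
      then if a 0 > a 1 then Violated 2 else Violated 0
      else if a 0 + a 1 < 1 then Violated 3 else Violated 1)"

text \<open>Positivity excludes the \<open>Satisfied\<close> case. Bounding over members instead of
  indices leaves one linear inequality per literal for a concrete list.\<close>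

lemma valid_response_ViolatedI:
  assumes "j < length \<Phi>" "violation_prob a (\<Phi> ! j) > 0"
    and "\<And>l. l \<in> set \<Phi> \<Longrightarrow> violation_prob a l \<le> violation_prob a (\<Phi> ! j)"
  shows "valid_response \<Phi> a (Violated j)"
proof -
  have "\<not> (\<forall>l\<in>set \<Phi>. violation_prob a l = 0)"
    using nth_mem[OF assms(1)] assms(2) by force
  moreover have "\<forall>k<length \<Phi>. violation_prob a (\<Phi> ! k) \<le> violation_prob a (\<Phi> ! j)"
    using assms(3) by simp
  ultimately show ?thesis
    using assms(1) unfolding valid_response_def by auto
qed

lemma query_range:
  assumes "a \<in> queries n" "i < n"
  shows "a i \<in> {0..1}"
  using PiE_mem[OF assms(1)[unfolded queries_def], of i] assms(2) by simp

lemma valid_responder_contradiction_twice: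
  "valid_responder 2 contradiction_twice confusing_responder"
  unfolding valid_responder_def
proof (intro allI ballI)
  fix h a assume "a \<in> queries 2"
  then have range: "a 0 \<in> {0..1}" by (rule query_range) simp
  have v: "violation_prob a (Pos 0) = 1 - a 0" "violation_prob a (Neg 0) = a 0"
    using violation_prob_Pos[of a 0, OF range] violation_prob_Neg[of a 0, OF range] .
  \<comment> \<open>Even indices carry \<open>Pos 0\<close>, worst when \<open>a 0\<close> is at
    most 1/2; odd ones carry \<open>Neg 0\<close>, worst otherwise. The larger probability is at
    least 1/2, hence positive.\<close>
  show "valid_response contradiction_twice a (confusing_responder h a)"
    by (auto simp: confusing_responder_def contradiction_twice_def v
        intro!: valid_response_ViolatedI)
qed

lemma valid_responder_contradiction_and_var:
  "valid_responder 2 contradiction_and_var confusing_responder"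
  unfolding valid_responder_def
proof (intro allI ballI)
  fix h a assume q: "a \<in> queries 2"
  have range: "a 0 \<in> {0..1}" "a 1 \<in> {0..1}"
    by (rule query_range[OF q], simp)+
  have v: "violation_prob a (Pos 0) = 1 - a 0" "violation_prob a (Neg 0) = a 0"
    "violation_prob a (Pos 1) = 1 - a 1"
    using violation_prob_Pos[of a 0, OF range(1)] violation_prob_Neg[of a 0, OF range(1)]
      violation_prob_Pos[of a 1, OF range(2)] .
  \<comment> \<open>In the branches for indices 2 and 3, \<open>1 - a 1\<close> exceeds the larger
    of \<open>a 0\<close> and \<open>1 - a 0\<close>, so it too is positive.
    \<open>v[simplified]\<close> matches the normal form \<open>Suc 0\<close> of the index
    \<open>1\<close>.\<close>
  show "valid_response contradiction_and_var a (confusing_responder h a)"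
    by (auto simp: confusing_responder_def contradiction_and_var_def v[simplified]
        intro!: valid_response_ViolatedI)
qed

theorem proposition2:
  "\<not> (\<exists>A :: nat \<Rightarrow> nat \<Rightarrow> algorithm. learns_unsatisfiable_1sat A)"
proof
  assume "\<exists>A :: nat \<Rightarrow> nat \<Rightarrow> algorithm. learns_unsatisfiable_1sat A"
  then obtain A :: "nat \<Rightarrow> nat \<Rightarrow> algorithm" where "learns_unsatisfiable_1sat A" ..
  then have "set contradiction_twice = set contradiction_and_var"
  proof (rule learner_output_determined)
    show "length contradiction_twice = length contradiction_and_var"
      by (simp add: contradiction_twice_def contradiction_and_var_def)
    show "is_1sat 2 contradiction_twice" "is_1sat 2 contradiction_and_var"
      by (simp_all add: is_1sat_def contradiction_twice_def contradiction_and_var_def)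
    show "\<not> satisfiable contradiction_twice" "\<not> satisfiable contradiction_and_var"
      by (simp_all add: satisfiable_def contradiction_twice_def contradiction_and_var_def)
  qed (fact valid_responder_contradiction_twice valid_responder_contradiction_and_var)+
  moreover have "Pos 1 \<in> set contradiction_and_var" "Pos 1 \<notin> set contradiction_twice"
    by (simp_all add: contradiction_twice_def contradiction_and_var_def)
  ultimately show False by simp
qed

end
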